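(* Let $f\in\mathbb{R}^n\to\mathbb{R}$ be the function computed by an expression $e$ under an interpretation $I$ (with domain $\mathbb{R}$) that assigns Cauchy-continuous functions to the operation symbols in $e$. Let $F$ be the function computed by $e$ under the canonical interval extension of $I$. Let $\langle A_i\rangle_{i\in\mathbb{N}}$ be nested boxes converging to $\{a\}$. Then $\langle F(A_i)\rangle_{i\in\mathbb{N}}$ is a sequence of nested intervals converging to $\{f(a)\}$.
   Context: Functions are partial: $f\in S\to T$ means that $f$ associates each element of a subset $\mathrm{dom}(f)\subset S$ with a unique element of $T$; $f$ is total if $\mathrm{dom}(f)=S$. For $X\subset S$, $\{f(x)\mid x\in X\}$ means the set of $y\in T$ such that $f$ associates some $x\in X$ with $y$. The composition $g\circ f$ of $f\in S\to T$ and $g\in T\to U$ associates $x$ with $z$ iff there is $y$ with $f$ mapping $x$ to $y$ and $g$ mapping $y$ to $z$. For $f_1\in S_1\to T_1$, $f_2\in S_2\to T_2$, the function $f_1\times f_2\in S_1\times S_2\to T_1\times T_2$ has domain $\mathrm{dom}(f_1)\times\mathrm{dom}(f_2)$ and maps $\langle x_1,x_2\rangle$ to $\langle f_1(x_1),f_2(x_2)\rangle$. Expressions: a variable is an expression; if $E$ is an expression and $\varphi$ a unary operation symbol, then $\varphi E$ is an expression; if $E_1,E_2$ are expressions and $\diamond$ is a binary operation symbol, then $E_1\diamond E_2$ is an expression. The variable sequence of $e$ is the sequence of its distinct variables in order of first occurrence. An interpretation for an expression consists of a set $D$ (its domain) and a map $M$ sending each $k$-ary operation symbol in the expression to a (partial)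 function in $D^k\to D$, $k\in\{1,2\}$. Distribution function: let $e_1,e_2$ have variable sequences $\langle v_1,\ldots,v_m\rangle$ and $\langle w_1,\ldots,w_n\rangle$, and let $w_{j_1},\ldots,w_{j_q}$ ($j_1<\cdots<j_q$) be those $w_j$ that do not occur in $e_1$ (so the variable sequence of $e_1\diamond e_2$ is $\langle v_1,\ldots,v_m,w_{j_1},\ldots,w_{j_q}\rangle$). The distribution function $\delta\in D^{m+q}\to D^m\times D^n$ for $\langle e_1,e_2\rangle$ and $D$ maps $\langle x_1,\ldots,x_m,y_{j_1},\ldots,y_{j_q}\rangle$ to $\langle\langle x_1,\ldots,x_m\rangle,\langle y_1,\ldots,y_n\rangle\rangle$, where for each $w_i$ occurring in $e_1$, say $w_i=v_k$, one has $y_i=x_k$. Function computed by $e$ under an interpretation with domain $D$ and map $M$, by recursion: if $e$ is a variable, it is the identity function on $D$; if $e$ is $\varphi e_1$, it is $M(\varphi)\circ f_1$ where $f_1$ is the function computed by $e_1$; if $e$ is $e_1\diamond e_2$, it is $M(\diamond)\circ(f_1\times f_2)\circ\delta$, where $f_1,f_2$ are the functions computed by $e_1,e_2$ and $\delta$ is the distribution function for $\langle e_1,e_2\rangle$ and $D$. Intervals are the closed connected subsets of $\mathbb{R}$, including $\emptyset$ and unbounded ones: $\{x\le b\}$, $\{x\ge a\}$, $\{a\le x\le b\}$, $\mathbb{R}$. Let $\mathcal{I}$ be the set of intervals. A box in $\mathbb{R}^n$ is a Cartesian product of $n$ intervals; a tuple $\langle X_1,\ldots,X_n\rangle$ of intervals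 is identified with the box $X_1\times\cdots\times X_n$. A set extension of $g\in S\to T$ is a total function $G$ from subsets of $S$ to subsets of $T$ such that $\{g(x)\mid x\in X\}\subset G(X)$ for all $X\subset S$. For $g\in\mathbb{R}^k\to\mathbb{R}$, an interval extension of $g$ is a function $G\in\mathcal{I}^k\to\mathcal{I}$ that is the restriction to $\mathcal{I}^k$ of a set extension of $g$. The canonical interval extension $G$ of $g$ is defined by $G(B)=\{g(x)\mid x\in B\}$ whenever this is an interval. The canonical interval extension of an interpretation $I$ with domain $\mathbb{R}$ and map $M$ is the interpretation over intervals that maps every operation symbol $p$ to the canonical interval extension of $M(p)$. Existence of these extensions is not a separate hypothesis of the claim: it is taken to follow from Cauchy-continuity (every Cauchy-continuous function is taken to have a canonical interval extension). $g\in\mathbb{R}^k\to\mathbb{R}$ is Cauchy-continuous at $c\in\mathbb{R}^k$ iff for every $\epsilon>0$ there is $\delta>0$ such that $\|x-c\|\le\delta$ and $x\in\mathrm{dom}(g)$ imply $|g(x)-g(c)|\le\epsilon$ ($\|\cdot\|$ Euclidean). $g$ is Cauchy-continuous if it is so at every $c\in\mathrm{dom}(g)$. A sequence of sets $\langle S_i\rangle$ is nested if $S_{i+1}\subset S_i$ for all $i$; a nested sequence (of boxes, respectively of intervals) converges to $\{a\}$ if $\bigcap_i S_i=\{a\}$. *)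

theory Defs
  imports "HOL-Analysis.Analysis" "HOL-Library.NList"
begin

definition pimage :: "('a \<rightharpoonup> 'b) \<Rightarrow> 'a set \<Rightarrow> 'b set" where
  "pimage f X = {y. \<exists>x\<in>X. f x = Some y}"

definition pprod :: "('a \<rightharpoonup> 'c) \<Rightarrow> ('b \<rightharpoonup> 'd) \<Rightarrow> ('a \<times> 'b \<rightharpoonup> 'c \<times> 'd)" where
  "pprod f g = (\<lambda>(x, y). case (f x, g y) of (Some x', Some y') \<Rightarrow> Some (x', y') | _ \<Rightarrow> None)"

datatype (vars: 'v, unops: 'u, binops: 'b) expr =
    Var 'v
  | Unary 'u "('v, 'u, 'b) expr"
  | Binary 'b "('v, 'u, 'b) expr" "('v, 'u, 'b) expr"

primrec occurrences :: "('v, 'u, 'b) expr \<Rightarrow> 'v list" where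
  "occurrences (Var v) = [v]"
| "occurrences (Unary p e) = occurrences e"
| "occurrences (Binary p e1 e2) = occurrences e1 @ occurrences e2"

(* remdups keeps the last occurrence of each element; the reversals make it keep the first. *)
definition varseq :: "('v, 'u, 'b) expr \<Rightarrow> 'v list" where
  "varseq e = rev (remdups (rev (occurrences e)))"

lemma set_varseq: "set (varseq e) = vars e"
proof -
  have "set (occurrences e) = vars e" by (induction e) auto
  then show ?thesis by (simp add: varseq_def)
qed

lemma distinct_varseq: "distinct (varseq e)"
  by (simp add: varseq_def)

lemma remdups_append_filter:
  "remdups (xs @ ys) = filter (\<lambda>x. x \<notin> set ys) (remdups xs) @ remdups ys"
  by (induction xs) auto

lemma varseq_Binary:
  "varseq (Binary p e1 e2) = varseq e1 @ filter (\<lambda>w. w \<notin> set (varseq e1)) (varseq e2)"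
  by (simp add: varseq_def remdups_append_filter rev_filter)

(* D^1 is identified with D. Only the values at the symbols occurring in the expression
   under consideration matter. *)
record ('d, 'u, 'b) interp =
  idom :: "'d set"
  iun :: "'u \<Rightarrow> 'd \<rightharpoonup> 'd"
  ibin :: "'b \<Rightarrow> 'd \<times> 'd \<rightharpoonup> 'd"

definition interprets :: "('d, 'u, 'b) interp \<Rightarrow> ('v, 'u, 'b) expr \<Rightarrow> bool" where
  "interprets I e \<longleftrightarrow>
     (\<forall>p\<in>unops e. dom (iun I p) \<subseteq> idom I \<and> ran (iun I p) \<subseteq> idom I) \<and>
     (\<forall>p\<in>binops e. dom (ibin I p) \<subseteq> idom I \<times> idom I \<and> ran (ibin I p) \<subseteq> idom I)"

(* For variable sequences vs and ws. The association list zip us zs gives each variable of the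
   compound expression its argument; a variable of ws that also occurs in vs thus gets the
   argument of its occurrence in vs. *)
definition distribution :: "'d set \<Rightarrow> 'v list \<Rightarrow> 'v list \<Rightarrow> ('d list \<rightharpoonup> 'd list \<times> 'd list)" where
  "distribution D vs ws = (\<lambda>zs.
     let us = vs @ filter (\<lambda>w. w \<notin> set vs) ws in
     if zs \<in> nlists (length us) D
     then Some (take (length vs) zs, map (\<lambda>w. the (map_of (zip us zs) w)) ws)
     else None)"

primrec computed :: "('d, 'u, 'b) interp \<Rightarrow> ('v, 'u, 'b) expr \<Rightarrow> ('d list \<rightharpoonup> 'd)" where
  "computed I (Var v) = (\<lambda>xs. if xs \<in> nlists 1 (idom I) then Some (hd xs) else None)"
| "computed I (Unary p e) = iun I p \<circ>\<^sub>m computed I e"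
| "computed I (Binary p e1 e2) =
     ibin I p \<circ>\<^sub>m pprod (computed I e1) (computed I e2)
       \<circ>\<^sub>m distribution (idom I) (varseq e1) (varseq e2)"

definition intervals :: "real set set" where
  "intervals = {X. closed X \<and> connected X}"

definition set_extension :: "('a \<rightharpoonup> 'b) \<Rightarrow> ('a set \<Rightarrow> 'b set) \<Rightarrow> bool" where
  "set_extension g G \<longleftrightarrow> (\<forall>X. pimage g X \<subseteq> G X)"

(* The image of a box need not be an interval: it need not be closed (exp on a half-line) nor,
   for partial g, connected (1/x on [-1,1]). In that case the canonical value is the least
   interval containing the image. *)
definition canonical :: "('a \<rightharpoonup> real) \<Rightarrow> 'a set \<Rightarrow> real set" where
  "canonical g B =
     (if pimage g B \<in> intervals then pimage g B
      else \<Inter>{X \<in> intervals. pimage g B \<subseteq> X})"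

lemma set_extension_canonical: "set_extension g (canonical g)"
  by (auto simp: set_extension_def canonical_def)

lemma canonical_in_intervals: "canonical g B \<in> intervals"
proof -
  have Inter: "\<Inter>\<X> \<in> intervals" if "\<X> \<subseteq> intervals" for \<X>
  proof -
    have "closed (\<Inter>\<X>)" using that by (auto simp: intervals_def)
    have "is_interval X" if "X \<in> \<X>" for X
      using that \<open>\<X> \<subseteq> intervals\<close> by (auto simp: intervals_def is_interval_connected_1)
    then have "is_interval (\<Inter>\<X>)"
      unfolding is_interval_1 by blast
    with \<open>closed (\<Inter>\<X>)\<close> show ?thesis
      by (simp add: intervals_def is_interval_connected_1)
  qed
  have "\<Inter>{X \<in> intervals. pimage g B \<subseteq> X} \<in> intervals"
    by (rule Inter) blast
  then show ?thesis by (simp add: canonical_def)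
qed

lemma canonical_least: "X \<in> intervals \<Longrightarrow> pimage g B \<subseteq> X \<Longrightarrow> canonical g B \<subseteq> X"
  by (auto simp: canonical_def)

definition canonical_interp :: "(real, 'u, 'b) interp \<Rightarrow> (real set, 'u, 'b) interp" where
  "canonical_interp I =
     \<lparr> idom = intervals,
       iun = (\<lambda>p. (\<lambda>X. Some (canonical (iun I p) X)) |` intervals),
       ibin = (\<lambda>p. (\<lambda>(X, Y). Some (canonical (ibin I p) (X \<times> Y))) |` (intervals \<times> intervals)) \<rparr>"

lemma interprets_canonical_interp: "interprets (canonical_interp I) e"
  by (auto simp: interprets_def canonical_interp_def ran_def restrict_map_def
      canonical_in_intervals split: if_splits)

(* On real and real \<times> real, dist is the Euclidean distance. This is plain continuity relative to
   the domain, not preservation of Cauchy sequences (Cauchy_continuous_map). *)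
definition cauchy_continuous_at :: "('a::metric_space \<rightharpoonup> real) \<Rightarrow> 'a \<Rightarrow> bool" where
  "cauchy_continuous_at g c \<longleftrightarrow>
     (\<forall>\<epsilon>>0. \<exists>\<delta>>0. \<forall>x. dist x c \<le> \<delta> \<and> x \<in> dom g \<longrightarrow> \<bar>the (g x) - the (g c)\<bar> \<le> \<epsilon>)"

definition cauchy_continuous :: "('a::metric_space \<rightharpoonup> real) \<Rightarrow> bool" where
  "cauchy_continuous g \<longleftrightarrow> (\<forall>c\<in>dom g. cauchy_continuous_at g c)"

definition nested :: "(nat \<Rightarrow> 'a set) \<Rightarrow> bool" where
  "nested S \<longleftrightarrow> (\<forall>i. S (Suc i) \<subseteq> S i)"

definition converges_to :: "(nat \<Rightarrow> 'a set) \<Rightarrow> 'a \<Rightarrow> bool" where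
  "converges_to S a \<longleftrightarrow> (\<Inter>i. S i) = {a}"

end

theory Submission imports Defs begin

text \<open>
  A nested sequence of intervals with intersection \<open>{x}\<close> eventually lies in every
  neighbourhood of \<open>x\<close>: by connectedness an interval that contains \<open>x\<close> but not
  \<open>x - \<epsilon>\<close> and \<open>x + \<epsilon>\<close> stays between them. With this uniform form of convergence, continuity at
  the limit passes to canonical interval extensions, because the closed neighbourhoods of the value
  are themselves intervals. The theorem then follows by induction on the expression, provided that
  its arguments are given by an assignment of values to variables, which the distribution
  function merely restricts to the two subexpressions.
\<close>

section \<open>Monotonicity of nested sequences, canonical extensions and boxes\<close>

lemma nested_antimono: "nested S \<Longrightarrow> i \<le> j \<Longrightarrow> S j \<subseteq> S i"
  unfolding nested_def by (rule lift_Suc_antimono_le) auto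

lemma canonical_superset: "pimage g B \<subseteq> canonical g B"
  using set_extension_canonical[of g] by (auto simp: set_extension_def)

lemma canonical_mono: "B \<subseteq> C \<Longrightarrow> canonical g B \<subseteq> canonical g C"
  by (rule canonical_least[OF canonical_in_intervals])
    (use canonical_superset[of g C] in \<open>auto simp: pimage_def\<close>)

lemma in_listset_iff:
  "xs \<in> listset As \<longleftrightarrow> length xs = length As \<and> (\<forall>k<length As. xs ! k \<in> As ! k)"
proof (induction As arbitrary: xs)
  case Nil
  then show ?case by simp
next
  case (Cons A As)
  then show ?case
    by (cases xs) (auto simp: set_Cons_def nth_Cons less_Suc_eq_0_disj split: nat.split)
qed

text \<open>The point \<open>a\<close> shows that the smaller box is nonempty: a box with an empty
  factor is empty and would not constrain the other coordinates. Replacing one entry of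
  \<open>a\<close> isolates a coordinate.\<close>

lemma listset_coord_mono:
  assumes "listset As \<subseteq> listset Bs" "a \<in> listset As" "k < length As"
  shows "As ! k \<subseteq> Bs ! k"
proof
  fix x assume "x \<in> As ! k"
  with assms(2,3) have "a[k := x] \<in> listset As"
    by (auto simp: in_listset_iff nth_list_update)
  with assms(1) have "a[k := x] \<in> listset Bs" by blast
  with assms(2,3) show "x \<in> Bs ! k"
    by (auto simp: in_listset_iff dest: spec[of _ k])
qed

section \<open>Sequences of intervals shrinking to a point\<close>

definition shrinks_to :: "(nat \<Rightarrow> real set) \<Rightarrow> real \<Rightarrow> bool" where
  "shrinks_to X x \<longleftrightarrow> (\<forall>i. X i \<in> intervals) \<and> nested X \<and> converges_to X x"

lemma shrinks_to_mem: "shrinks_to X x \<Longrightarrow> x \<in> X i"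
  by (auto simp: shrinks_to_def converges_to_def)

lemma shrinks_to_cball:
  assumes X: "shrinks_to X x" and "\<epsilon> > 0"
  shows "\<exists>i. X i \<subseteq> cball x \<epsilon>"
proof -
  \<comment> \<open>Since \<open>x\<close> is the only common point, each of its two neighbours at
    distance \<epsilon> is missed by some member of the sequence, and by all later ones.\<close>
  have "x + \<epsilon> \<notin> (\<Inter>i. X i)" "x - \<epsilon> \<notin> (\<Inter>i. X i)"
    using assms by (auto simp: shrinks_to_def converges_to_def)
  then obtain i j where ij: "x + \<epsilon> \<notin> X i" "x - \<epsilon> \<notin> X j" by blast
  let ?k = "max i j"
  have "X ?k \<subseteq> X i" "X ?k \<subseteq> X j"
    using X by (simp_all add: shrinks_to_def nested_antimono)
  with ij have k: "x + \<epsilon> \<notin> X ?k" "x - \<epsilon> \<notin> X ?k" by blast+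
  have "is_interval (X ?k)"
    using X by (auto simp: shrinks_to_def intervals_def is_interval_connected_1)
  then have between: "c \<in> X ?k" if "b \<in> X ?k" "d \<in> X ?k" "b \<le> c" "c \<le> d" for b c d
    using that unfolding is_interval_1 by blast
  have "y \<in> cball x \<epsilon>" if "y \<in> X ?k" for y
    using between[of x y "x + \<epsilon>"] between[of y x "x - \<epsilon>"] that k shrinks_to_mem[OF X, of ?k] \<open>\<epsilon> > 0\<close>
    unfolding mem_cball dist_real_def by linarith
  then show ?thesis by blast
qed

text \<open>The sets \<open>B i\<close> range over an arbitrary metric space, so that unary
  operations (on reals) and binary ones (on pairs) are treated together. That \<open>g\<close> is
  defined at the limit \<open>x\<close> keeps \<open>y\<close> in every image.\<close>

lemma canonical_shrinks_to:
  fixes g :: "'a::metric_space \<rightharpoonup> real"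
  assumes "nested B" and mem: "\<And>i. x \<in> B i" and small: "\<And>\<delta>. \<delta> > 0 \<Longrightarrow> \<exists>i. B i \<subseteq> cball x \<delta>"
    and g: "cauchy_continuous g" "g x = Some y"
  shows "shrinks_to (\<lambda>i. canonical g (B i)) y"
proof -
  have y: "y \<in> canonical g (B i)" for i
    using mem g(2) canonical_superset[of g "B i"] by (auto simp: pimage_def)
  have small_image: "\<exists>i. canonical g (B i) \<subseteq> cball y \<epsilon>" if "\<epsilon> > 0" for \<epsilon>
  proof -
    have "cauchy_continuous_at g x"
      using g by (auto simp: cauchy_continuous_def)
    then obtain \<delta> where "\<delta> > 0"
      and \<delta>: "\<And>z. dist z x \<le> \<delta> \<Longrightarrow> z \<in> dom g \<Longrightarrow> \<bar>the (g z) - the (g x)\<bar> \<le> \<epsilon>"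
      using \<open>\<epsilon> > 0\<close> by (auto simp: cauchy_continuous_at_def)
    from small[OF \<open>\<delta> > 0\<close>] obtain i where i: "B i \<subseteq> cball x \<delta>" ..
    have "pimage g (B i) \<subseteq> cball y \<epsilon>"
    proof
      fix w assume "w \<in> pimage g (B i)"
      then obtain z where z: "z \<in> B i" "g z = Some w" by (auto simp: pimage_def)
      then have "dist z x \<le> \<delta>" using i by (auto simp: dist_commute)
      from \<delta>[OF this] z g(2) show "w \<in> cball y \<epsilon>"
        by (auto simp: dist_real_def abs_minus_commute)
    qed
    \<comment> \<open>The ball is an interval, so passing from the image to the least interval
      around it does not leave the ball.\<close>
    then have "canonical g (B i) \<subseteq> cball y \<epsilon>"
      by (intro canonical_least) (auto simp: intervals_def convex_connected)
    then show ?thesis ..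
  qed
  have "dist y z \<le> 0" if "\<And>i. z \<in> canonical g (B i)" for z
  proof (rule field_le_epsilon)
    fix \<epsilon> :: real assume "\<epsilon> > 0"
    with small_image obtain i where "canonical g (B i) \<subseteq> cball y \<epsilon>" by blast
    with that[of i] show "dist y z \<le> 0 + \<epsilon>" by auto
  qed
  then have "z = y" if "\<And>i. z \<in> canonical g (B i)" for z
    using that by (metis dist_le_zero_iff)
  with y have "converges_to (\<lambda>i. canonical g (B i)) y"
    by (auto simp: converges_to_def)
  moreover have "nested (\<lambda>i. canonical g (B i))"
    using assms(1) by (simp add: nested_def canonical_mono)
  ultimately show ?thesis
    by (simp add: shrinks_to_def canonical_in_intervals)
qed

text \<open>The Euclidean distance of pairs is at most the sum of the coordinate distances, so half
  of \<delta> suffices in each coordinate.\<close>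

lemma shrinks_to_Times_cball:
  assumes X: "shrinks_to X x" and Y: "shrinks_to Y y" and "\<delta> > 0"
  shows "\<exists>i. X i \<times> Y i \<subseteq> cball (x, y) \<delta>"
proof -
  from shrinks_to_cball[OF X, of "\<delta>/2"] shrinks_to_cball[OF Y, of "\<delta>/2"] \<open>\<delta> > 0\<close>
  obtain i j where ij: "X i \<subseteq> cball x (\<delta>/2)" "Y j \<subseteq> cball y (\<delta>/2)" by auto
  let ?k = "max i j"
  have "X ?k \<subseteq> X i" "Y ?k \<subseteq> Y j"
    using X Y by (simp_all add: shrinks_to_def nested_antimono)
  with ij have "X ?k \<times> Y ?k \<subseteq> cball x (\<delta>/2) \<times> cball y (\<delta>/2)" by blast
  also have "\<dots> \<subseteq> cball (x, y) \<delta>"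
  proof clarsimp
    fix u v assume "dist x u * 2 \<le> \<delta>" "dist y v * 2 \<le> \<delta>"
    moreover have "dist (x, y) (u, v) \<le> dist x u + dist y v"
      by (simp add: dist_Pair_Pair sqrt_sum_squares_le_sum)
    ultimately show "dist (x, y) (u, v) \<le> \<delta>" by linarith
  qed
  finally show ?thesis ..
qed

section \<open>Evaluation under an assignment of values to variables\<close>

lemma map_the_map_of_zip:
  assumes "distinct us" "length us = length zs"
  shows "map (\<lambda>v. the (map_of (zip us zs) v)) us = zs"
  using assms by (auto intro!: nth_equalityI simp: map_of_zip_nth[OF assms(2,1)])

text \<open>Looking up a variable among the arguments returns its value under \<open>\<rho>\<close>,
  whether the variable is shared or occurs only in \<open>ws\<close>. The positions of the arguments
  thus disappear from the induction.\<close>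

lemma distribution_map:
  assumes "\<And>v. v \<in> set vs \<union> set ws \<Longrightarrow> \<rho> v \<in> D"
  shows "distribution D vs ws (map \<rho> (vs @ filter (\<lambda>w. w \<notin> set vs) ws))
    = Some (map \<rho> vs, map \<rho> ws)"
proof -
  let ?us = "vs @ filter (\<lambda>w. w \<notin> set vs) ws"
  have "map \<rho> ?us \<in> nlists (length ?us) D"
    using assms by (intro nlistsI) auto
  moreover have "the (map_of (zip ?us (map \<rho> ?us)) w) = \<rho> w" if "w \<in> set ws" for w
    unfolding map_of_zip_map using that by simp
  then have "map (\<lambda>w. the (map_of (zip ?us (map \<rho> ?us)) w)) ws = map \<rho> ws"
    by (intro map_cong refl)
  moreover have "take (length vs) (map \<rho> ?us) = map \<rho> vs"
    by simp
  ultimately show ?thesis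
    unfolding distribution_def Let_def by (simp only: if_True)
qed

lemma computed_Binary_map:
  assumes "\<And>v. v \<in> vars (Binary p e1 e2) \<Longrightarrow> \<rho> v \<in> idom I"
  shows "computed I (Binary p e1 e2) (map \<rho> (varseq (Binary p e1 e2)))
    = (ibin I p \<circ>\<^sub>m pprod (computed I e1) (computed I e2)) (map \<rho> (varseq e1), map \<rho> (varseq e2))"
  using distribution_map[of "varseq e1" "varseq e2" \<rho> "idom I"] assms
  by (simp add: varseq_Binary set_varseq map_comp_def)

lemma varseq_Unary: "varseq (Unary p e) = varseq e"
  by (simp add: varseq_def)

lemma idom_canonical_interp: "idom (canonical_interp I) = intervals"
  by (simp add: canonical_interp_def)

lemma iun_canonical_interp:
  "X \<in> intervals \<Longrightarrow> iun (canonical_interp I) p X = Some (canonical (iun I p) X)"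
  by (simp add: canonical_interp_def)

lemma ibin_canonical_interp:
  "X \<in> intervals \<Longrightarrow> Y \<in> intervals \<Longrightarrow>
    ibin (canonical_interp I) p (X, Y) = Some (canonical (ibin I p) (X \<times> Y))"
  by (simp add: canonical_interp_def)

text \<open>Only the point evaluation has to be assumed defined, since canonical extensions are
  total on intervals.\<close>

lemma computed_shrinks_to:
  fixes e :: "('v, 'u, 'b) expr" and I :: "(real, 'u, 'b) interp"
  assumes "idom I = UNIV"
    and "\<forall>p\<in>unops e. cauchy_continuous (iun I p)"
    and "\<forall>p\<in>binops e. cauchy_continuous (ibin I p)"
    and "\<And>v. v \<in> vars e \<Longrightarrow> shrinks_to (\<rho> v) (r v)"
    and "computed I e (map r (varseq e)) = Some y"
  shows "\<exists>Y. shrinks_to Y y \<and>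
    (\<forall>i. computed (canonical_interp I) e (map (\<lambda>v. \<rho> v i) (varseq e)) = Some (Y i))"
  using assms(2-)
proof (induction e arbitrary: y)
  case (Var v)
  then show ?case
    by (intro exI[of _ "\<rho> v"])
      (auto simp: varseq_def idom_canonical_interp assms(1) in_nlists_Suc_iff shrinks_to_def)
next
  case (Unary p e)
  \<comment> \<open>A defined value of the whole expression forces a defined value of the
    subexpression, which is the limit required by the induction hypothesis.\<close>
  from Unary.prems(4) obtain x
    where x: "computed I e (map r (varseq e)) = Some x" "iun I p x = Some y"
    by (auto simp: varseq_Unary map_comp_def split: option.splits)
  with Unary.IH[of x] Unary.prems obtain X where X: "shrinks_to X x"
    "\<And>i. computed (canonical_interp I) e (map (\<lambda>v. \<rho> v i) (varseq e)) = Some (X i)"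
    by auto
  have "shrinks_to (\<lambda>i. canonical (iun I p) (X i)) y"
    using X(1) x(2) Unary.prems(1) shrinks_to_mem[OF X(1)] shrinks_to_cball[OF X(1)]
    by (intro canonical_shrinks_to[where x = x]) (auto simp: shrinks_to_def)
  moreover have "X i \<in> intervals" for i
    using X(1) by (simp add: shrinks_to_def)
  ultimately show ?case
    by (intro exI[of _ "\<lambda>i. canonical (iun I p) (X i)"])
      (simp add: varseq_Unary X(2) map_comp_def iun_canonical_interp)
next
  case (Binary p e1 e2)
  from Binary.prems(4) obtain x1 x2
    where x: "computed I e1 (map r (varseq e1)) = Some x1"
      "computed I e2 (map r (varseq e2)) = Some x2" "ibin I p (x1, x2) = Some y"
    using computed_Binary_map[of p e1 e2 r I] assms(1)
    by (auto simp del: computed.simps simp: map_comp_def pprod_def split: option.splits)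
  from Binary.IH(1)[of x1] Binary.prems x obtain X1 where X1: "shrinks_to X1 x1"
    "\<And>i. computed (canonical_interp I) e1 (map (\<lambda>v. \<rho> v i) (varseq e1)) = Some (X1 i)"
    by auto
  from Binary.IH(2)[of x2] Binary.prems x obtain X2 where X2: "shrinks_to X2 x2"
    "\<And>i. computed (canonical_interp I) e2 (map (\<lambda>v. \<rho> v i) (varseq e2)) = Some (X2 i)"
    by auto
  have nested: "nested (\<lambda>i. X1 i \<times> X2 i)"
    using X1(1) X2(1) by (auto simp: shrinks_to_def nested_def)
  have "shrinks_to (\<lambda>i. canonical (ibin I p) (X1 i \<times> X2 i)) y"
    using x(3) Binary.prems(2) shrinks_to_mem[OF X1(1)] shrinks_to_mem[OF X2(1)]
      shrinks_to_Times_cball[OF X1(1) X2(1)]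
    by (intro canonical_shrinks_to[where x = "(x1, x2)", OF nested]) auto
  moreover have "X1 i \<in> intervals" "X2 i \<in> intervals" for i
    using X1(1) X2(1) by (simp_all add: shrinks_to_def)
  \<comment> \<open>The same splitting of arguments, now for the interval assignment at index
    \<open>i\<close>.\<close>
  moreover have "computed (canonical_interp I) (Binary p e1 e2)
      (map (\<lambda>v. \<rho> v i) (varseq (Binary p e1 e2)))
    = (ibin (canonical_interp I) p \<circ>\<^sub>m
        pprod (computed (canonical_interp I) e1) (computed (canonical_interp I) e2))
      (map (\<lambda>v. \<rho> v i) (varseq e1), map (\<lambda>v. \<rho> v i) (varseq e2))" for i
    using Binary.prems(3)
    by (intro computed_Binary_map) (auto simp: shrinks_to_def idom_canonical_interp)
  ultimately show ?case
    by (intro exI[of _ "\<lambda>i. canonical (ibin I p) (X1 i \<times> X2 i)"])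
      (simp del: computed.simps add: X1(2) X2(2) map_comp_def pprod_def ibin_canonical_interp)
qed

theorem corollary1:
  fixes e :: "('v, 'u, 'b) expr"
    and I :: "(real, 'u, 'b) interp"
    and f :: "real list \<rightharpoonup> real"
    and F :: "real set list \<rightharpoonup> real set"
    and A :: "nat \<Rightarrow> real set list"
    and a :: "real list"
  assumes "idom I = UNIV"
    and "interprets I e"
    and "\<forall>p\<in>unops e. cauchy_continuous (iun I p)"
    and "\<forall>p\<in>binops e. cauchy_continuous (ibin I p)"
    and "f = computed I e"
    and "F = computed (canonical_interp I) e"
    and "\<forall>i. A i \<in> nlists (length (varseq e)) intervals"
    and "nested (\<lambda>i. listset (A i))"
    and "converges_to (\<lambda>i. listset (A i)) a"
    and "a \<in> dom f"
  shows "(\<forall>i. A i \<in> dom F \<and> the (F (A i)) \<in> intervals)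
    \<and> nested (\<lambda>i. the (F (A i)))
    \<and> converges_to (\<lambda>i. the (F (A i))) (the (f a))"
proof -
  let ?vs = "varseq e"
  have len: "length (A i) = length ?vs" for i
    using assms(7) by (blast dest: nlistsE_length)
  have a: "a \<in> listset (A i)" for i
    using assms(9) by (auto simp: converges_to_def)
  then have len_a: "length a = length ?vs"
    using len by (auto simp: in_listset_iff)
  have coord: "shrinks_to (\<lambda>i. A i ! k) (a ! k)" if k: "k < length ?vs" for k
  proof -
    have "A i ! k \<in> intervals" for i
      using assms(7) k by (blast intro: nlistsE_nth_in)
    moreover have "nested (\<lambda>i. A i ! k)"
      using assms(8) k len listset_coord_mono[OF _ a] by (auto simp: nested_def)
    moreover have "(\<Inter>i. A i ! k) = {a ! k}"
    proof
      show "{a ! k} \<subseteq> (\<Inter>i. A i ! k)"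
        using a k len by (auto simp: in_listset_iff)
      show "(\<Inter>i. A i ! k) \<subseteq> {a ! k}"
      proof
        fix x assume "x \<in> (\<Inter>i. A i ! k)"
        \<comment> \<open>Moving only the \<open>k\<close>-th entry of \<open>a\<close> to
          \<open>x\<close> stays inside every box, and the boxes have no common point but
          \<open>a\<close>.\<close>
        then have "a[k := x] \<in> (\<Inter>i. listset (A i))"
          using a k len_a by (auto simp: in_listset_iff nth_list_update)
        then have "a[k := x] = a"
          using assms(9) unfolding converges_to_def by blast
        then show "x \<in> {a ! k}"
          using k len_a nth_list_update_eq[of k a x] by simp
      qed
    qed
    ultimately show ?thesis by (simp add: shrinks_to_def converges_to_def)
  qed
  \<comment> \<open>The variables in \<open>?vs\<close> are distinct, so lookup recovers the
    argument lists from these assignments.\<close>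
  define r where "r v = the (map_of (zip ?vs a) v)" for v
  define \<rho> where "\<rho> v i = the (map_of (zip ?vs (A i)) v)" for v i
  have r: "map r ?vs = a"
    unfolding r_def by (rule map_the_map_of_zip) (simp_all add: distinct_varseq len_a)
  have \<rho>: "map (\<lambda>v. \<rho> v i) ?vs = A i" for i
    unfolding \<rho>_def by (rule map_the_map_of_zip) (simp_all add: distinct_varseq len)
  have "shrinks_to (\<rho> v) (r v)" if "v \<in> vars e" for v
  proof -
    from that obtain k where k: "k < length ?vs" "v = ?vs ! k"
      by (metis in_set_conv_nth set_varseq)
    \<comment> \<open>Rewriting \<open>a\<close> as \<open>map r ?vs\<close> reads off the entry
      without unfolding the lookup.\<close>
    then have "r v = a ! k"
      by (simp flip: r)
    moreover have "\<rho> v = (\<lambda>i. A i ! k)"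
      using k by (simp flip: \<rho>)
    ultimately show ?thesis using coord[OF k(1)] by simp
  qed
  moreover from assms(5,10) obtain y where y: "computed I e a = Some y" by auto
  then have "computed I e (map r ?vs) = Some y" by (simp add: r)
  ultimately obtain Y where "shrinks_to Y y" "\<And>i. computed (canonical_interp I) e (A i) = Some (Y i)"
    using computed_shrinks_to[OF assms(1,3,4), of \<rho> r y] unfolding \<rho> by blast
  with y assms(5,6) show ?thesis
    by (auto simp: shrinks_to_def)
qed

end
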